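(* Let $0<\delta<1$, $\zeta>0$ and $\rho>0$. Let $\varepsilon_a$ and $\varepsilon_r$ be positive numbers such that $0<\varepsilon_a<\frac{35}{94}$ and $\frac{70\varepsilon_a}{35-24\varepsilon_a}<\varepsilon_r<1$. Define $$\nu=\frac{\varepsilon_a+\varepsilon_r\varepsilon_a-\varepsilon_r}{\varepsilon_r\ln(1+\varepsilon_r)}\ln\left(1+\frac{\varepsilon_r^2}{\varepsilon_r-\varepsilon_a-\varepsilon_r\varepsilon_a}\right),\qquad \tau=\left\lfloor\frac{\ln(1+\nu)}{\ln(1+\rho)}\right\rfloor .$$ Let $n_1<n_2<\cdots<n_s$ be the ascending arrangement of all distinct elements of $$\left\{\left\lceil(1+\nu)^{-\frac{i}{\tau}}\,\frac{\ln\frac{1}{\zeta\delta}}{\ln(1+\varepsilon_r)}\right\rceil : i\in\mathbb Z,\ \tau\le i\le0\right\}.$$ Let $p\in(0,1)$ and let $X_1,X_2,\ldots$ be i.i.d. Bernoulli random variables with $\Pr\{X_i=1\}=1-\Pr\{X_i=0\}=p$. For $\ell=1,\ldots,s$ define $K_\ell=\sum_{i=1}^{n_\ell}X_i$, $\widehat{p}_\ell=\frac{K_\ell}{n_\ell}$, $\underline{p}_\ell=\min\left\{\widehat{p}_\ell-\varepsilon_a,\frac{\widehat{p}_\ell}{1+\varepsilon_r}\right\}$ and $\overline{p}_\ell=\max\left\{\widehat{p}_\ell+\varepsilon_a,\frac{\widehat{p}_\ell}{1-\varepsilon_r}\right\}$. Suppose sampling is continued until $S_{\mathrm B}(K_\ell,n_\ell,n_\ell,\underline{p}_\ell)\le\zeta\delta$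 and $S_{\mathrm B}(0,K_\ell,n_\ell,\overline{p}_\ell)\le\zeta\delta$ for some $\ell\in\{1,\ldots,s\}$. Let $\widehat{p}=\frac{\sum_{i=1}^{\mathbf n}X_i}{\mathbf n}$, where $\mathbf n$ is the sample size when the sampling is terminated. Then $\Pr\left\{|\widehat{p}-p|<\varepsilon_a\ \text{or}\ \left|\frac{\widehat{p}-p}{p}\right|<\varepsilon_r\right\}\ge1-\delta$ for every $p\in(0,1)$, provided that $0<\zeta\le\frac{1}{2(1-\tau)}$.
   Context: For integers $0\le k\le l\le n$ and real $p$, $S_{\mathrm B}(k,l,n,p)=\sum_{i=k}^{l}\binom{n}{i}p^i(1-p)^{n-i}$ if $p\in(0,1)$, and $S_{\mathrm B}(k,l,n,p)=0$ if $p\notin(0,1)$. Under the hypotheses $-1<\nu<0$ and $\tau$ is a negative integer. The sampling proceeds through stages $\ell=1,2,\ldots,s$, where at stage $\ell$ a total of $n_\ell$ samples has been observed; it terminates at the first stage $\ell$ at which the stopping condition holds, and then $\mathbf n=n_\ell$ and $\widehat{p}=\widehat{p}_\ell$. *)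

theory Defs
  imports "HOL-Probability.Probability"
begin

definition S_B :: "nat \<Rightarrow> nat \<Rightarrow> nat \<Rightarrow> real \<Rightarrow> real" where
  "S_B k l n p =
    (if p \<in> {0<..<1} then \<Sum>i=k..l. real (n choose i) * p ^ i * (1 - p) ^ (n - i) else 0)"

definition nu :: "real \<Rightarrow> real \<Rightarrow> real" where
  "nu \<epsilon>\<^sub>a \<epsilon>\<^sub>r =
    (\<epsilon>\<^sub>a + \<epsilon>\<^sub>r * \<epsilon>\<^sub>a - \<epsilon>\<^sub>r) / (\<epsilon>\<^sub>r * ln (1 + \<epsilon>\<^sub>r))
      * ln (1 + \<epsilon>\<^sub>r\<^sup>2 / (\<epsilon>\<^sub>r - \<epsilon>\<^sub>a - \<epsilon>\<^sub>r * \<epsilon>\<^sub>a))"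

definition tau :: "real \<Rightarrow> real \<Rightarrow> real \<Rightarrow> int" where
  "tau \<epsilon>\<^sub>a \<epsilon>\<^sub>r \<rho> = \<lfloor>ln (1 + nu \<epsilon>\<^sub>a \<epsilon>\<^sub>r) / ln (1 + \<rho>)\<rfloor>"

definition sample_sizes :: "real \<Rightarrow> real \<Rightarrow> real \<Rightarrow> real \<Rightarrow> real \<Rightarrow> int set" where
  "sample_sizes \<epsilon>\<^sub>a \<epsilon>\<^sub>r \<rho> \<zeta> \<delta> =
    {\<lceil>(1 + nu \<epsilon>\<^sub>a \<epsilon>\<^sub>r) powr (- (real_of_int i / real_of_int (tau \<epsilon>\<^sub>a \<epsilon>\<^sub>r \<rho>)))
        * (ln (1 / (\<zeta> * \<delta>)) / ln (1 + \<epsilon>\<^sub>r))\<rceil> | i :: int. tau \<epsilon>\<^sub>a \<epsilon>\<^sub>r \<rho> \<le> i \<and> i \<le> 0}"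

definition p_hat :: "nat \<Rightarrow> nat \<Rightarrow> real" where
  "p_hat m k = real k / real m"

definition p_lower :: "real \<Rightarrow> real \<Rightarrow> real \<Rightarrow> real" where
  "p_lower \<epsilon>\<^sub>a \<epsilon>\<^sub>r q = min (q - \<epsilon>\<^sub>a) (q / (1 + \<epsilon>\<^sub>r))"

definition p_upper :: "real \<Rightarrow> real \<Rightarrow> real \<Rightarrow> real" where
  "p_upper \<epsilon>\<^sub>a \<epsilon>\<^sub>r q = max (q + \<epsilon>\<^sub>a) (q / (1 - \<epsilon>\<^sub>r))"

text \<open>The stopping condition at a stage with \<open>m\<close> samples, \<open>k\<close> of which are successes;
  \<open>c\<close> is the threshold \<open>\<zeta> * \<delta>\<close>.\<close>

definition stop_cond :: "real \<Rightarrow> real \<Rightarrow> real \<Rightarrow> nat \<Rightarrow> nat \<Rightarrow> bool" where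
  "stop_cond \<epsilon>\<^sub>a \<epsilon>\<^sub>r c m k \<longleftrightarrow>
    S_B k m m (p_lower \<epsilon>\<^sub>a \<epsilon>\<^sub>r (p_hat m k)) \<le> c \<and>
    S_B 0 k m (p_upper \<epsilon>\<^sub>a \<epsilon>\<^sub>r (p_hat m k)) \<le> c"

text \<open>For at most one \<open>l\<close> does \<open>terminates_at s P l\<close> hold, and for none if no stage
  in \<open>{1..s}\<close> satisfies the stopping condition \<open>P\<close>.\<close>

definition terminates_at :: "nat \<Rightarrow> (nat \<Rightarrow> bool) \<Rightarrow> nat \<Rightarrow> bool" where
  "terminates_at s P l \<longleftrightarrow> l \<in> {1..s} \<and> P l \<and> (\<forall>j\<in>{1..<l}. \<not> P j)"

end

theory Submission
  imports Defs
begin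

text \<open>
  If the final estimate misses both error margins at stage \<open>l\<close>, then \<open>p\<close> lies below the lower or above
  the upper limit \<open>p_lower\<close>, \<open>p_upper\<close>, and monotonicity of binomial tails in \<open>p\<close> turns the stopping
  condition into the event that a p-value of \<open>K l\<close> under the true \<open>p\<close> is at most \<open>\<zeta> * \<delta>\<close>; that event has
  probability at most \<open>\<zeta> * \<delta>\<close>. Two tails and at most \<open>1 - \<tau>\<close> stages give \<open>2 * (1 - \<tau>) * \<zeta> * \<delta> \<le> \<delta>\<close>.

  Sampling stops almost surely since the stopping condition always holds at the largest stage. Put
  \<open>p\<^sub>0 = \<epsilon>\<^sub>a / \<epsilon>\<^sub>r\<close>, where absolute and relative margin coincide. The number \<open>(1 + \<nu>) * ln (1 + \<epsilon>\<^sub>r)\<close> is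
  the relative entropy of \<open>p\<^sub>0 + \<epsilon>\<^sub>a\<close> with respect to \<open>p\<^sub>0\<close>. Chernoff's bound is used with the
  exponential tilting that is optimal at \<open>(p\<^sub>0 + \<epsilon>\<^sub>a, p\<^sub>0)\<close> for upper tails and at \<open>(p\<^sub>0 - \<epsilon>\<^sub>a, p\<^sub>0)\<close> for
  lower tails, whatever the observed value \<open>z\<close>. The resulting exponent is the tangent plane of the
  relative entropy at that point, so it is affine along the two line segments that make up the graph of
  \<open>p_lower\<close> or \<open>p_upper\<close>, and only the signs of the slopes matter; the bounds on \<open>\<epsilon>\<^sub>a\<close> and \<open>\<epsilon>\<^sub>r\<close> give
  the sign for \<open>p_lower\<close> on the absolute segment.
\<close>

section \<open>Binomial tails\<close>

definition binom_weight :: "nat \<Rightarrow> real \<Rightarrow> nat \<Rightarrow> real" where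
  "binom_weight n p i = real (n choose i) * p ^ i * (1 - p) ^ (n - i)"

lemma binom_weight_0: "binom_weight 0 p i = (if i = 0 then 1 else 0)"
  by (cases i) (auto simp: binom_weight_def)

lemma binom_weight_Suc_0: "binom_weight (Suc n) p 0 = (1 - p) * binom_weight n p 0"
  by (simp add: binom_weight_def)

lemma binom_weight_Suc_Suc:
  "binom_weight (Suc n) p (Suc i) = p * binom_weight n p i + (1 - p) * binom_weight n p (Suc i)"
proof (cases "i < n")
  case True
  then have "n - i = Suc (n - Suc i)" by simp
  then have "(1 - p) ^ (n - i) = (1 - p) * (1 - p) ^ (n - Suc i)" by (metis power_Suc)
  then show ?thesis
    by (simp add: binom_weight_def distrib_left distrib_right mult_ac)
next
  case False
  then show ?thesis by (cases "i = n") (auto simp: binom_weight_def binomial_eq_0)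
qed

lemma binom_weight_nonneg: "0 \<le> p \<Longrightarrow> p \<le> 1 \<Longrightarrow> 0 \<le> binom_weight n p i"
  by (simp add: binom_weight_def)

lemma sum_binom_weight: "(\<Sum>i\<le>n. binom_weight n p i) = 1"
  using binomial_ring[of p "1 - p" n] by (simp add: binom_weight_def)

lemma S_B_eq_sum_binom_weight:
  "0 < p \<Longrightarrow> p < 1 \<Longrightarrow> S_B k l n p = (\<Sum>i=k..l. binom_weight n p i)"
  by (simp add: S_B_def binom_weight_def)

text \<open>Conditioning on one trial: it succeeds with probability \<open>p\<close>, and then
  \<open>k\<close> further successes suffice; otherwise \<open>Suc k\<close> are required.\<close>

lemma upper_tail_Suc_Suc:
  "(\<Sum>i=Suc k..Suc n. binom_weight (Suc n) p i) =
     p * (\<Sum>i=k..n. binom_weight n p i) + (1 - p) * (\<Sum>i=Suc k..n. binom_weight n p i)"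
proof -
  have "(\<Sum>i=k..n. binom_weight n p (Suc i)) = (\<Sum>i=Suc k..Suc n. binom_weight n p i)"
    by (simp only: sum.shift_bounds_cl_Suc_ivl)
  also have "\<dots> = (\<Sum>i=Suc k..n. binom_weight n p i)"
    by (auto simp: binom_weight_def)
  finally show ?thesis
    by (simp only: sum.shift_bounds_cl_Suc_ivl binom_weight_Suc_Suc sum.distrib flip: sum_distrib_left)
qed

lemma upper_tail_antimono:
  assumes "0 \<le> p" "p \<le> 1"
  shows "(\<Sum>i=Suc k..n. binom_weight n p i) \<le> (\<Sum>i=k..n. binom_weight n p i)"
  using assms by (intro sum_mono2) (auto simp: binom_weight_nonneg)

text \<open>Induction on the number of trials replaces differentiation. After conditioning on one
  trial, the tail is a convex combination of two tails for \<open>n\<close> trials; a larger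
  parameter raises both and moves weight to the larger one.\<close>

lemma upper_tail_mono:
  assumes "0 \<le> p" "p \<le> q" "q \<le> 1"
  shows "(\<Sum>i=k..n. binom_weight n p i) \<le> (\<Sum>i=k..n. binom_weight n q i)"
proof (induction n arbitrary: k)
  case 0
  show ?case by (simp add: binom_weight_0)
next
  case (Suc n)
  show ?case
  proof (cases k)
    case 0
    then show ?thesis
      using sum_binom_weight[of "Suc n"] by (simp add: atLeast0AtMost)
  next
    case [simp]: (Suc j)
    let ?U = "\<lambda>q k. \<Sum>i=k..n. binom_weight n q i"
    have "p * ?U p j + (1 - p) * ?U p (Suc j) \<le> p * ?U q j + (1 - p) * ?U q (Suc j)"
      using assms Suc.IH by (intro add_mono mult_left_mono) auto
    also have "\<dots> = ?U q (Suc j) + p * (?U q j - ?U q (Suc j))"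
      by (simp add: algebra_simps)
    also have "\<dots> \<le> ?U q (Suc j) + q * (?U q j - ?U q (Suc j))"
      using assms upper_tail_antimono[of q n j] by (intro add_left_mono mult_right_mono) auto
    also have "\<dots> = q * ?U q j + (1 - q) * ?U q (Suc j)"
      by (simp add: algebra_simps)
    finally show ?thesis
      by (simp only: Suc upper_tail_Suc_Suc)
  qed
qed

lemma lower_tail_conv_upper_tail:
  assumes "k \<le> n"
  shows "(\<Sum>i=0..k. binom_weight n p i) = 1 - (\<Sum>i=Suc k..n. binom_weight n p i)"
proof -
  have "{..n} = {0..k} \<union> {Suc k..n}" using assms by auto
  then have "1 = (\<Sum>i=0..k. binom_weight n p i) + (\<Sum>i=Suc k..n. binom_weight n p i)"
    using sum_binom_weight[of n p] by (simp add: sum.union_disjoint)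
  then show ?thesis by simp
qed

lemma lower_tail_antimono_prob:
  assumes "0 \<le> p" "p \<le> q" "q \<le> 1" "k \<le> n"
  shows "(\<Sum>i=0..k. binom_weight n q i) \<le> (\<Sum>i=0..k. binom_weight n p i)"
  unfolding lower_tail_conv_upper_tail[OF assms(4)]
  by (intro diff_left_mono upper_tail_mono assms)

text \<open>Chernoff exponent per sample for the weights \<open>r ^ i * r' ^ (n - i)\<close>, after \<open>ln y \<le> y - 1\<close>. As a
  function of \<open>(z, m)\<close> it is the tangent plane of the relative entropy at the point \<open>(z, m)\<close> with
  \<open>z = m * r\<close> and \<open>1 - z = (1 - m) * r'\<close>.\<close>

definition chernoff_exponent :: "real \<Rightarrow> real \<Rightarrow> real \<Rightarrow> real \<Rightarrow> real" where
  "chernoff_exponent r r' z m = z * ln r + (1 - z) * ln r' + 1 - m * r - (1 - m) * r'"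

text \<open>Markov's inequality for the tilted weight: on \<open>I\<close> it is at least its value
  at \<open>k\<close>, and its mean is \<open>(m * r + (1 - m) * r') ^ n\<close>. The direction of
  the tail enters only through \<open>dom\<close>, so both tails are covered.\<close>

lemma chernoff_weights:
  assumes "0 < r" "0 < r'" "0 \<le> m" "m \<le> 1" "k \<le> n" "I \<subseteq> {..n}"
    and dom: "\<And>i. i \<in> I \<Longrightarrow> r ^ k * r' ^ (n - k) \<le> r ^ i * r' ^ (n - i)"
  shows "(\<Sum>i\<in>I. binom_weight n m i)
           \<le> exp (- real n * chernoff_exponent r r' (real k / real n) m)"
\<comment> \<open>For \<open>n = 0\<close> the bound is \<open>exp 0 = 1\<close>; otherwise the
  denominator of \<open>real k / real n\<close> can be cleared.\<close>
proof (cases "n = 0")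
  case True
  have "(\<Sum>i\<in>I. binom_weight n m i) \<le> (\<Sum>i\<le>n. binom_weight n m i)"
    using assms by (intro sum_mono2) (auto simp: binom_weight_nonneg)
  then show ?thesis using True by (simp add: binom_weight_0)
next
  case False
  let ?w = "r ^ k * r' ^ (n - k)" and ?y = "m * r + (1 - m) * r'"
  have w: "?w = exp (real n * (real k / real n * ln r + (1 - real k / real n) * ln r'))"
  proof -
    have "?w = exp (real k * ln r) * exp (real (n - k) * ln r')"
      using assms by (simp only: exp_of_nat_mult exp_ln)
    also have "\<dots> = exp (real k * ln r + (real n - real k) * ln r')"
      using assms by (simp only: exp_add of_nat_diff)
    also have "real k * ln r + (real n - real k) * ln r' =
        real n * (real k / real n * ln r + (1 - real k / real n) * ln r')"
      using False by (simp add: field_simps)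
    finally show ?thesis .
  qed
  have "(\<Sum>i\<in>I. binom_weight n m i) * ?w \<le> (\<Sum>i\<in>I. binom_weight n m i * (r ^ i * r' ^ (n - i)))"
    unfolding sum_distrib_right using assms
    by (intro sum_mono mult_left_mono dom binom_weight_nonneg) auto
  also have "\<dots> \<le> (\<Sum>i\<le>n. binom_weight n m i * (r ^ i * r' ^ (n - i)))"
    using assms by (intro sum_mono2) (auto intro!: mult_nonneg_nonneg binom_weight_nonneg)
  also have "\<dots> = ?y ^ n"
    unfolding binomial_ring binom_weight_def
    by (intro sum.cong refl) (simp only: power_mult_distrib mult_ac)
  \<comment> \<open>Using \<open>y \<le> exp (y - 1)\<close> here makes the final exponent affine in
    \<open>m\<close>.\<close>
  also have "\<dots> \<le> exp (?y - 1) ^ n"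
    using assms exp_ge_add_one_self[of "?y - 1"] by (intro power_mono) auto
  also have "\<dots> = exp (real n * (?y - 1))"
    by (simp add: exp_of_nat_mult)
  finally have "(\<Sum>i\<in>I. binom_weight n m i) \<le> exp (real n * (?y - 1)) / ?w"
    using assms by (simp add: pos_le_divide_eq)
  also have "\<dots> = exp (- real n * chernoff_exponent r r' (real k / real n) m)"
    unfolding w exp_diff[symmetric] chernoff_exponent_def by (simp add: algebra_simps)
  finally show ?thesis .
qed

text \<open>With \<open>r' \<le> r\<close> the weight is nondecreasing in \<open>i\<close>, which
  gives the domination above \<open>k\<close>; the lower tail reverses the order of \<open>r\<close>
  and \<open>r'\<close>.\<close>

lemma upper_tail_chernoff:
  assumes "0 < r'" "r' \<le> r" "0 \<le> m" "m \<le> 1" "k \<le> n"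
  shows "(\<Sum>i=k..n. binom_weight n m i)
           \<le> exp (- real n * chernoff_exponent r r' (real k / real n) m)"
proof (rule chernoff_weights)
  fix i assume i: "i \<in> {k..n}"
  have "r ^ k * r' ^ (n - k) = r ^ k * (r' ^ (i - k) * r' ^ (n - i))"
    using i by (simp flip: power_add)
  also have "\<dots> \<le> r ^ k * (r ^ (i - k) * r' ^ (n - i))"
    using assms by (intro mult_left_mono mult_right_mono power_mono) auto
  also have "\<dots> = r ^ i * r' ^ (n - i)"
    using i by (simp flip: power_add mult.assoc)
  finally show "r ^ k * r' ^ (n - k) \<le> r ^ i * r' ^ (n - i)" .
qed (use assms in auto)

lemma lower_tail_chernoff:
  assumes "0 < r" "r \<le> r'" "0 \<le> m" "m \<le> 1" "k \<le> n"
  shows "(\<Sum>i=0..k. binom_weight n m i)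
           \<le> exp (- real n * chernoff_exponent r r' (real k / real n) m)"
proof (rule chernoff_weights)
  fix i assume i: "i \<in> {0..k}"
  have "r ^ k * r' ^ (n - k) = r ^ i * (r ^ (k - i) * r' ^ (n - k))"
    using i by (simp flip: power_add mult.assoc)
  also have "\<dots> \<le> r ^ i * (r' ^ (k - i) * r' ^ (n - k))"
    using assms by (intro mult_left_mono mult_right_mono power_mono) auto
  also have "\<dots> = r ^ i * r' ^ (n - i)"
    using i assms by (simp flip: power_add)
  finally show "r ^ k * r' ^ (n - k) \<le> r ^ i * r' ^ (n - i)" .
qed (use assms in auto)

section \<open>Sums of Bernoulli variables\<close>

text \<open>All qualifying counts are at least the least qualifying \<open>k\<close>, so the event
  lies in \<open>k \<le> K \<le> n\<close>, whose probability is the tail at \<open>k\<close>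
  itself.\<close>

lemma (in prob_space) binomial_tail_p_value_upper:
  fixes K :: "'a \<Rightarrow> nat"
  assumes [measurable]: "K \<in> measurable M (count_space UNIV)"
    and dist: "\<And>k. prob {\<omega> \<in> space M. K \<omega> = k} = binom_weight n p k"
    and p: "0 \<le> p" "p \<le> 1" and c: "0 \<le> c"
  shows "prob {\<omega> \<in> space M. K \<omega> \<le> n \<and> (\<Sum>i=K \<omega>..n. binom_weight n p i) \<le> c} \<le> c"
proof (cases "\<exists>k\<le>n. (\<Sum>i=k..n. binom_weight n p i) \<le> c")
  case False
  then have "{\<omega> \<in> space M. K \<omega> \<le> n \<and> (\<Sum>i=K \<omega>..n. binom_weight n p i) \<le> c} = {}" by auto
  then show ?thesis using c by (simp only: measure_empty)
next
  case True
  define k where "k = (LEAST k. k \<le> n \<and> (\<Sum>i=k..n. binom_weight n p i) \<le> c)"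
  have k: "k \<le> n" "(\<Sum>i=k..n. binom_weight n p i) \<le> c"
    using True unfolding k_def by (metis (mono_tags, lifting) LeastI_ex)+
  have "prob {\<omega> \<in> space M. K \<omega> \<le> n \<and> (\<Sum>i=K \<omega>..n. binom_weight n p i) \<le> c}
      \<le> prob (\<Union>i\<in>{k..n}. {\<omega> \<in> space M. K \<omega> = i})"
    by (rule finite_measure_mono) (auto simp: k_def intro!: Least_le)
  also have "\<dots> \<le> (\<Sum>i=k..n. prob {\<omega> \<in> space M. K \<omega> = i})"
    by (rule finite_measure_subadditive_finite) auto
  finally show ?thesis using k by (simp add: dist)
qed

text \<open>Mirror image with the greatest qualifying count, which exists because counts are bounded
  by \<open>n\<close>.\<close>

lemma (in prob_space) binomial_tail_p_value_lower:
  fixes K :: "'a \<Rightarrow> nat"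
  assumes [measurable]: "K \<in> measurable M (count_space UNIV)"
    and dist: "\<And>k. prob {\<omega> \<in> space M. K \<omega> = k} = binom_weight n p k"
    and p: "0 \<le> p" "p \<le> 1" and c: "0 \<le> c"
  shows "prob {\<omega> \<in> space M. K \<omega> \<le> n \<and> (\<Sum>i=0..K \<omega>. binom_weight n p i) \<le> c} \<le> c"
proof (cases "\<exists>k\<le>n. (\<Sum>i=0..k. binom_weight n p i) \<le> c")
  case False
  then have "{\<omega> \<in> space M. K \<omega> \<le> n \<and> (\<Sum>i=0..K \<omega>. binom_weight n p i) \<le> c} = {}" by auto
  then show ?thesis using c by (simp only: measure_empty)
next
  case True
  define k where "k = (GREATEST k. k \<le> n \<and> (\<Sum>i=0..k. binom_weight n p i) \<le> c)"
  have k: "k \<le> n" "(\<Sum>i=0..k. binom_weight n p i) \<le> c"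
    using True GreatestI_ex_nat[of "\<lambda>k. k \<le> n \<and> (\<Sum>i=0..k. binom_weight n p i) \<le> c" n]
    unfolding k_def by auto
  have "j \<le> k" if "j \<le> n" "(\<Sum>i=0..j. binom_weight n p i) \<le> c" for j
    unfolding k_def by (rule Greatest_le_nat[where b = n]) (use that in auto)
  then have "prob {\<omega> \<in> space M. K \<omega> \<le> n \<and> (\<Sum>i=0..K \<omega>. binom_weight n p i) \<le> c}
      \<le> prob (\<Union>i\<in>{0..k}. {\<omega> \<in> space M. K \<omega> = i})"
    by (intro finite_measure_mono) auto
  also have "\<dots> \<le> (\<Sum>i=0..k. prob {\<omega> \<in> space M. K \<omega> = i})"
    by (rule finite_measure_subadditive_finite) auto
  finally show ?thesis using k by (simp add: dist)
qed

text \<open>Induction on \<open>m\<close>: conditioning on \<open>X (Suc m)\<close>, which is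
  independent of the earlier sum, reproduces the recursion of \<open>binom_weight\<close>.\<close>

lemma (in prob_space) sum_bernoulli_binomial:
  fixes X :: "nat \<Rightarrow> 'a \<Rightarrow> nat"
  assumes indep: "indep_vars (\<lambda>_. count_space UNIV) X {1..}"
    and X1: "\<And>i. i \<ge> 1 \<Longrightarrow> prob {\<omega> \<in> space M. X i \<omega> = 1} = p"
    and X0: "\<And>i. i \<ge> 1 \<Longrightarrow> prob {\<omega> \<in> space M. X i \<omega> = 0} = 1 - p"
  shows "prob {\<omega> \<in> space M. (\<Sum>i=1..m. X i \<omega>) = k} = binom_weight m p k"
proof (induction m arbitrary: k)
  case 0
  show ?case by (simp add: binom_weight_0 prob_space)
next
  case (Suc m)
  have rv[measurable]: "X i \<in> measurable M (count_space UNIV)" if "i \<ge> 1" for i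
    using indep that by (auto simp: indep_vars_def)
  let ?S = "\<lambda>\<omega>. \<Sum>i=1..m. X i \<omega>"
  have S[measurable]: "?S \<in> measurable M (count_space UNIV)"
    by (rule measurable_sum_nat) (auto intro: rv)
  have X[measurable]: "X (Suc m) \<in> measurable M (count_space UNIV)" by (rule rv) simp
  \<comment> \<open>The variables are cast to the reals to obtain independence of one variable from
    the sum of the others; singletons then lead back to natural values.\<close>
  have iv: "indep_vars (\<lambda>_. borel) (\<lambda>i \<omega>. real (X i \<omega>)) (insert (Suc m) {1..m})"
    by (rule indep_vars_compose2[OF indep_vars_subset[OF indep]]) auto
  have "indep_var borel (\<lambda>\<omega>. real (X (Suc m) \<omega>)) borel (\<lambda>\<omega>. \<Sum>i\<in>{1..m}. real (X i \<omega>))"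
    by (rule indep_vars_sum[OF _ _ iv]) auto
  note iv = this
  have joint: "prob {\<omega> \<in> space M. X (Suc m) \<omega> = a \<and> ?S \<omega> = b} =
      prob {\<omega> \<in> space M. X (Suc m) \<omega> = a} * prob {\<omega> \<in> space M. ?S \<omega> = b}" for a b
  proof -
    have "prob ((\<lambda>\<omega>. (real (X (Suc m) \<omega>), \<Sum>i\<in>{1..m}. real (X i \<omega>))) -` ({real a} \<times> {real b}) \<inter> space M) =
       prob ((\<lambda>\<omega>. real (X (Suc m) \<omega>)) -` {real a} \<inter> space M) *
       prob ((\<lambda>\<omega>. \<Sum>i\<in>{1..m}. real (X i \<omega>)) -` {real b} \<inter> space M)"
      by (rule indep_varD[OF iv]) auto
    moreover have "(\<lambda>\<omega>. (real (X (Suc m) \<omega>), \<Sum>i\<in>{1..m}. real (X i \<omega>))) -` ({real a} \<times> {real b}) \<inter> space M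
        = {\<omega> \<in> space M. X (Suc m) \<omega> = a \<and> ?S \<omega> = b}"
      unfolding of_nat_sum[symmetric] by (auto simp del: of_nat_sum)
    moreover have "(\<lambda>\<omega>. real (X (Suc m) \<omega>)) -` {real a} \<inter> space M = {\<omega> \<in> space M. X (Suc m) \<omega> = a}"
      by auto
    moreover have "(\<lambda>\<omega>. \<Sum>i\<in>{1..m}. real (X i \<omega>)) -` {real b} \<inter> space M = {\<omega> \<in> space M. ?S \<omega> = b}"
      unfolding of_nat_sum[symmetric] by (auto simp del: of_nat_sum)
    ultimately show ?thesis by simp
  qed
  \<comment> \<open>Values above 1 are possible on a null set, so for positive \<open>k\<close> the
    decomposition of the event holds only almost everywhere.\<close>
  have AE01: "AE \<omega> in M. X (Suc m) \<omega> \<in> {0, 1}"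
  proof -
    have "prob ({\<omega> \<in> space M. X (Suc m) \<omega> = 0} \<union> {\<omega> \<in> space M. X (Suc m) \<omega> = 1}) = 1"
      using X1[of "Suc m"] by (subst finite_measure_Union) (auto simp: X0)
    from AE_prob_1[OF this] show ?thesis by eventually_elim auto
  qed
  show ?case
  proof (cases k)
    case 0
    have "prob {\<omega> \<in> space M. (\<Sum>i=1..Suc m. X i \<omega>) = k} =
       prob {\<omega> \<in> space M. X (Suc m) \<omega> = 0 \<and> ?S \<omega> = 0}"
      using 0 by (intro arg_cong[where f = prob]) auto
    then show ?thesis
      unfolding joint Suc.IH using 0 X0[of "Suc m"] by (simp add: binom_weight_Suc_0)
  next
    case (Suc j)
    have "prob {\<omega> \<in> space M. (\<Sum>i=1..Suc m. X i \<omega>) = k} =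
       prob ({\<omega> \<in> space M. X (Suc m) \<omega> = 1 \<and> ?S \<omega> = j} \<union>
             {\<omega> \<in> space M. X (Suc m) \<omega> = 0 \<and> ?S \<omega> = Suc j})"
    proof (rule finite_measure_eq_AE)
      show "AE \<omega> in M. (\<omega> \<in> {\<omega> \<in> space M. (\<Sum>i=1..Suc m. X i \<omega>) = k}) =
        (\<omega> \<in> {\<omega> \<in> space M. X (Suc m) \<omega> = 1 \<and> ?S \<omega> = j} \<union>
             {\<omega> \<in> space M. X (Suc m) \<omega> = 0 \<and> ?S \<omega> = Suc j})"
        using AE01 by eventually_elim (use Suc in auto)
      have "(\<lambda>\<omega>. \<Sum>i=1..Suc m. X i \<omega>) \<in> measurable M (count_space UNIV)"
        by (rule measurable_sum_nat) (auto intro: rv)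
      note [measurable] = this
      show "{\<omega> \<in> space M. (\<Sum>i=1..Suc m. X i \<omega>) = k} \<in> events" by measurable
    qed measurable
    also have "\<dots> = p * binom_weight m p j + (1 - p) * binom_weight m p (Suc j)"
      using joint[of 1 j] joint[of 0 "Suc j"] X1[of "Suc m"] X0[of "Suc m"]
      by (subst finite_measure_Union) (auto simp: Suc.IH[unfolded One_nat_def])
    finally show ?thesis
      using Suc by (simp add: binom_weight_Suc_Suc)
  qed
qed

section \<open>Slopes of the exponent\<close>

text \<open>The slope along the absolute segments, where \<open>z\<close> and the limit move
  together.\<close>

lemma chernoff_exponent_shift:
  "chernoff_exponent r r' (z + x) (m + x) =
     chernoff_exponent r r' z m + x * (ln r - ln r' - r + r')"
  by (simp add: chernoff_exponent_def algebra_simps)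

text \<open>On the relative segments, rays \<open>m = z / r\<close>, the exponent is affine in
  \<open>z\<close>; its slope \<open>b\<close> is nonnegative by \<open>ln y \<le> y - 1\<close> at
  \<open>y = r' / r\<close>.\<close>

lemma chernoff_exponent_ray_mono:
  assumes "0 < r" "0 < r'" "z\<^sub>0 \<le> z"
  shows "chernoff_exponent r r' z\<^sub>0 (z\<^sub>0 / r) \<le> chernoff_exponent r r' z (z / r)"
proof -
  define b where "b = ln r - ln r' - 1 + r' / r"
  have "ln (r' / r) \<le> r' / r - 1"
    using assms by (intro ln_le_minus_one) simp
  then have "0 \<le> b"
    using assms by (simp add: b_def ln_div)
  then have "z\<^sub>0 * b \<le> z * b"
    using assms by (intro mult_right_mono)
  moreover have "chernoff_exponent r r' u (u / r) = u * b + (ln r' + 1 - r')" for u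
    using assms by (simp add: chernoff_exponent_def b_def algebra_simps)
  ultimately show ?thesis by simp
qed

text \<open>Sign of the slope for \<open>p_upper\<close> on its absolute segment, with
  \<open>t = e / p0\<close> and \<open>s = e / (1 - p0)\<close>. The case \<open>s = t\<close>
  follows from a derivative; passing to a smaller \<open>s\<close> costs at most
  \<open>t - s\<close>.\<close>

lemma ln_quotient_upper_slope_nonpos:
  fixes s t :: real
  assumes "0 \<le> s" "s \<le> t" "t < 1"
  shows "ln (1 - t) - ln (1 + s) + t + s \<le> 0"
proof -
  define f where "f u = ln (1 - u) - ln (1 + u) + 2 * u" for u :: real
  have "f t \<le> f 0"
  proof (rule DERIV_nonpos_imp_nonincreasing[where f = f])
    fix x :: real assume x: "0 \<le> x" "x \<le> t"
    have "(f has_real_derivative (- 1 / (1 - x) - 1 / (1 + x) + 2)) (at x)"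
      unfolding f_def using x assms by (auto intro!: derivative_eq_intros)
    moreover have "- 1 / (1 - x) - 1 / (1 + x) + 2 = - 2 * x\<^sup>2 / ((1 - x) * (1 + x))"
    proof -
      have "1 - x \<noteq> 0" "1 + x \<noteq> 0" using x assms by auto
      then show ?thesis by (simp add: divide_simps) (simp add: algebra_simps power2_eq_square)
    qed
    moreover have "\<dots> \<le> 0" using x assms by (intro divide_nonpos_nonneg) auto
    ultimately show "\<exists>y. (f has_real_derivative y) (at x) \<and> y \<le> 0" by auto
  qed (use assms in auto)
  moreover have "ln (1 + t) - ln (1 + s) \<le> t - s"
  proof -
    have "ln ((1 + t) / (1 + s)) \<le> (1 + t) / (1 + s) - 1"
      using assms by (intro ln_le_minus_one) simp
    also have "\<dots> = (t - s) / (1 + s)" using assms by (simp add: field_simps)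
    also have "\<dots> \<le> (t - s) / 1" using assms by (intro divide_left_mono) auto
    finally show ?thesis using assms by (simp add: ln_div)
  qed
  ultimately show ?thesis unfolding f_def by simp
qed

text \<open>Compares the relative entropies of \<open>p + e\<close> and \<open>p - e\<close> with
  respect to \<open>p\<close>, so that one rate serves both tails. The difference vanishes at
  deviation 0, and its derivative is the logarithm of a quotient that is at least 1 because
  \<open>p \<le> 1 / 2\<close>.\<close>

lemma relative_entropy_deviation_le:
  fixes p e :: real
  assumes "0 < e" "e < p" "p \<le> 1 / 2"
  shows "(p + e) * ln (1 + e / p) + (1 - p - e) * ln (1 - e / (1 - p))
       \<le> (p - e) * ln (1 - e / p) + (1 - p + e) * ln (1 + e / (1 - p))"
proof -
  define \<phi> :: "real \<Rightarrow> real" where "\<phi> y = y * ln y" for y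
  define f where "f x = p * \<phi> (1 - x / p) + (1 - p) * \<phi> (1 + x / (1 - p))
      - p * \<phi> (1 + x / p) - (1 - p) * \<phi> (1 - x / (1 - p))" for x
  \<comment> \<open>Up to sign, all four terms of \<open>f\<close> have this shape, with
    \<open>c\<close> equal to \<open>p\<close>, \<open>- p\<close>, \<open>1 - p\<close> or
    \<open>- (1 - p)\<close>.\<close>
  have \<phi>: "((\<lambda>x. c * \<phi> (1 + x / c)) has_real_derivative ln (1 + x / c) + 1) (at x)"
    if "c \<noteq> 0" "0 < 1 + x / c" for c x
  proof -
    have "(\<phi> has_real_derivative ln (1 + x / c) + 1) (at (1 + x / c))"
      unfolding \<phi>_def using that by (auto intro!: derivative_eq_intros)
    moreover have "((\<lambda>x. 1 + x / c) has_real_derivative 1 / c) (at x)"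
      using that by (auto intro!: derivative_eq_intros)
    ultimately have "((\<lambda>x. \<phi> (1 + x / c)) has_real_derivative (ln (1 + x / c) + 1) * (1 / c)) (at x)"
      by (rule DERIV_chain2)
    from DERIV_cmult[OF this, of c] show ?thesis using that by simp
  qed
  have "f 0 \<le> f e"
  proof (rule DERIV_nonneg_imp_nondecreasing[where f = f])
    fix x :: real assume x: "0 \<le> x" "x \<le> e"
    have pos: "0 < 1 - x / p" "0 < 1 - x / (1 - p)" "0 < 1 + x / p" "0 < 1 + x / (1 - p)"
      using x assms by (auto simp: field_simps intro: add_pos_nonneg)
    let ?D = "- (ln (1 - x / p) + 1) + (ln (1 + x / (1 - p)) + 1) - (ln (1 + x / p) + 1)
       - - (ln (1 - x / (1 - p)) + 1)"
    have "((\<lambda>x. p * \<phi> (1 - x / p)) has_real_derivative - (ln (1 - x / p) + 1)) (at x)"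
      using DERIV_minus[OF \<phi>[of "- p" x]] pos assms by simp
    moreover have "((\<lambda>x. (1 - p) * \<phi> (1 - x / (1 - p))) has_real_derivative
        - (ln (1 - x / (1 - p)) + 1)) (at x)"
      using DERIV_minus[OF \<phi>[of "- (1 - p)" x]] pos assms
      by (simp del: minus_diff_eq)
    ultimately have "(f has_real_derivative ?D) (at x)"
      unfolding f_def using pos assms by (intro DERIV_diff DERIV_add \<phi>) auto
    moreover have "0 \<le> ?D"
    proof -
      have "(x / (1 - p))\<^sup>2 \<le> (x / p)\<^sup>2"
        using x assms by (intro power_mono divide_left_mono) auto
      then have "(1 - x / p) * (1 + x / p) \<le> (1 + x / (1 - p)) * (1 - x / (1 - p))"
        by (simp add: power2_eq_square algebra_simps)
      then have "ln ((1 - x / p) * (1 + x / p)) \<le> ln ((1 + x / (1 - p)) * (1 - x / (1 - p)))"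
        using pos by (intro ln_mono) auto
      then show ?thesis using pos by (simp add: ln_mult_pos)
    qed
    ultimately show "\<exists>y. (f has_real_derivative y) (at x) \<and> 0 \<le> y" by auto
  qed (use assms in auto)
  moreover have "c * \<phi> (1 + y / c) = (c + y) * ln (1 + y / c)"
    "c * \<phi> (1 - y / c) = (c - y) * ln (1 - y / c)" if "c \<noteq> 0" for c y
    unfolding \<phi>_def using that by (simp_all add: field_simps)
  moreover have "f 0 = 0" by (simp add: f_def \<phi>_def)
  ultimately show ?thesis
    using assms by (simp add: f_def)
qed

text \<open>The derivative in \<open>p\<close> of the relative entropy of \<open>p + e\<close> with respect to \<open>p\<close>.\<close>

definition deviation_slope :: "real \<Rightarrow> real \<Rightarrow> real" where
  "deviation_slope e p = ln (1 + e / p) - ln (1 - e / (1 - p)) - e / p - e / (1 - p)"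

text \<open>The four terms of the derivative pair up, two in \<open>x\<close> and two in
  \<open>1 - x\<close>, and each pair combines to a nonnegative fraction with numerator
  \<open>e\<^sup>2\<close>.\<close>

lemma deviation_slope_mono:
  assumes "0 < e" "0 < p" "p \<le> q" "q < 1 - e"
  shows "deviation_slope e p \<le> deviation_slope e q"
proof (rule DERIV_nonneg_imp_nondecreasing[where f = "deviation_slope e"])
  fix x assume x: "p \<le> x" "x \<le> q"
  have pos: "0 < x" "0 < 1 - x" "0 < 1 - x - e" "0 < x + e"
    "0 < 1 + e / x" "0 < 1 - e / (1 - x)"
    using x assms by (auto simp: field_simps intro: add_pos_nonneg)
  let ?D = "- e / (x * (x + e)) + e / ((1 - x) * (1 - x - e)) + e / x\<^sup>2 - e / (1 - x)\<^sup>2"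
  have "((\<lambda>x. ln (1 + e / x)) has_real_derivative (- e / (x * (x + e)))) (at x)"
    using pos by (auto intro!: derivative_eq_intros simp: field_simps power2_eq_square)
  moreover have "((\<lambda>x. ln (1 - e / (1 - x))) has_real_derivative (- e / ((1 - x) * (1 - x - e)))) (at x)"
  proof -
    have "((\<lambda>x. ln (1 - e / (1 - x))) has_real_derivative
        (- e / (1 - x)\<^sup>2) / (1 - e / (1 - x))) (at x)"
      using pos by (auto intro!: derivative_eq_intros simp: power2_eq_square)
    moreover have "1 - e / (1 - x) = (1 - x - e) / (1 - x)"
      using pos by (simp add: field_simps)
    ultimately show ?thesis using pos by (simp add: power2_eq_square)
  qed
  moreover have "((\<lambda>x. e / x) has_real_derivative (- e / x\<^sup>2)) (at x)"
    using pos by (auto intro!: derivative_eq_intros simp: divide_simps power2_eq_square)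
  moreover have "((\<lambda>x. e / (1 - x)) has_real_derivative (e / (1 - x)\<^sup>2)) (at x)"
    using pos by (auto intro!: derivative_eq_intros simp: divide_simps power2_eq_square)
  ultimately have "(deviation_slope e has_real_derivative (- e / (x * (x + e))
      - (- e / ((1 - x) * (1 - x - e))) - (- e / x\<^sup>2) - (e / (1 - x)\<^sup>2))) (at x)"
    unfolding deviation_slope_def by (intro DERIV_diff)
  then have "(deviation_slope e has_real_derivative ?D) (at x)" by simp
  moreover have "0 \<le> ?D"
  proof -
    have "0 \<le> e\<^sup>2 / (x\<^sup>2 * (x + e))" "0 \<le> e\<^sup>2 / ((1 - x)\<^sup>2 * (1 - x - e))"
      using pos by auto
    moreover have "e / x\<^sup>2 - e / (x * (x + e)) = e\<^sup>2 / (x\<^sup>2 * (x + e))"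
      using pos by (simp add: divide_simps power2_eq_square) (simp add: algebra_simps)
    moreover have "e / ((1 - x) * (1 - x - e)) - e / (1 - x)\<^sup>2 = e\<^sup>2 / ((1 - x)\<^sup>2 * (1 - x - e))"
      using pos by (simp add: divide_simps power2_eq_square) (simp add: algebra_simps)
    ultimately show ?thesis by simp
  qed
  ultimately show "\<exists>y. (deviation_slope e has_real_derivative y) (at x) \<and> 0 \<le> y" by auto
qed (use assms in auto)

text \<open>The slack is below 0.001; eleven terms of the exponential series suffice to certify
  it.\<close>

lemma ln_59_12_le: "ln (59 / 12) \<le> (658 / 413 :: real)"
proof -
  let ?x = "658 / 413 :: real"
  have "59 / 12 \<le> (\<Sum>k<11. inverse (fact k) * ?x ^ k)"
    by (simp add: lessThan_nat_numeral fact_numeral eval_nat_numeral)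
  also have "\<dots> \<le> (\<Sum>k. inverse (fact k) * ?x ^ k)"
    by (rule sum_le_suminf[OF summable_exp]) auto
  also have "\<dots> = exp ?x"
    by (simp only: exp_def real_scaleR_def)
  finally have "ln (59 / 12) \<le> ln (exp ?x)"
    by (intro ln_mono) auto
  then show ?thesis by simp
qed

lemma add_divide_conjugates:
  fixes c u :: real
  assumes "1 + u \<noteq> 0" "1 - u \<noteq> 0"
  shows "c / (1 + u) + c / (1 - u) = 2 * c / (1 - u\<^sup>2)"
proof -
  have "1 - u\<^sup>2 = (1 + u) * (1 - u)" by (simp add: algebra_simps power2_eq_square)
  then show ?thesis using assms by (simp only:) (simp add: divide_simps, simp add: algebra_simps)
qed

text \<open>The function below is \<open>deviation_slope e (1 / 2 - 12 / 35 * e)\<close> for \<open>x = 2 * e\<close>. It decreases and then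
  increases, so only the right end \<open>x = 35 / 47\<close>, that is \<open>e = 35 / 94\<close>, has to be checked; there it
  equals \<open>ln (59 / 12) - 658 / 413\<close>, which is about \<open>- 0.0006\<close>.\<close>

lemma critical_slope_nonpos:
  fixes x :: real
  assumes "0 \<le> x" "x \<le> 35 / 47"
  defines "f \<equiv> \<lambda>x. ln (1 + 23/35 * x) - ln (1 - 23/35 * x) + ln (1 + 12/35 * x) - ln (1 - 12/35 * x)
     - 2 * x / (1 - (12/35 * x)\<^sup>2)"
  shows "f x \<le> 0"
proof -
  have small: "0 < 1 - 23/35 * y" "0 < 1 - 12/35 * y" "0 < 1 + 23/35 * y" "0 < 1 + 12/35 * y"
      "0 < 1 - (12/35 * y)\<^sup>2" "0 < 1 - (23/35 * y)\<^sup>2" if "0 \<le> y" "y \<le> 35/47" for y :: real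
  proof -
    have *: "1 - (12/35 * y)\<^sup>2 = (1 - 12/35 * y) * (1 + 12/35 * y)"
      "1 - (23/35 * y)\<^sup>2 = (1 - 23/35 * y) * (1 + 23/35 * y)"
      by (simp_all add: algebra_simps power2_eq_square)
    show "0 < 1 - 23/35 * y" "0 < 1 - 12/35 * y" "0 < 1 + 23/35 * y" "0 < 1 + 12/35 * y"
      using that by auto
    then show "0 < 1 - (12/35 * y)\<^sup>2" "0 < 1 - (23/35 * y)\<^sup>2" unfolding * by simp_all
  qed
  \<comment> \<open>Only \<open>3312 * y\<^sup>2 - 1225\<close> can change sign, once, at
    \<open>y\<close> about 0.608. Here 42875 is the cube of 35, and 3312 is 144 times 23.\<close>
  define D where "D y = 2 * y\<^sup>2 * (3312 * y\<^sup>2 - 1225) / 42875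
      / ((1 - (12/35 * y)\<^sup>2)\<^sup>2 * (1 - (23/35 * y)\<^sup>2))" for y :: real
  have deriv: "(f has_real_derivative D y) (at y)" if y: "0 \<le> y" "y \<le> 35/47" for y
  proof -
    note s = small[OF y]
    define A where "A = 1 - (12/35 * y)\<^sup>2"
    define B where "B = 1 - (23/35 * y)\<^sup>2"
    have AB: "0 < A" "0 < B" using s by (simp_all add: A_def B_def)
    have "((\<lambda>x. ln (1 + 23/35 * x)) has_real_derivative (23/35) / (1 + 23/35 * y)) (at y)"
      "((\<lambda>x. ln (1 - 23/35 * x)) has_real_derivative - (23/35) / (1 - 23/35 * y)) (at y)"
      "((\<lambda>x. ln (1 + 12/35 * x)) has_real_derivative (12/35) / (1 + 12/35 * y)) (at y)"
      "((\<lambda>x. ln (1 - 12/35 * x)) has_real_derivative - (12/35) / (1 - 12/35 * y)) (at y)"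
      using s by (auto intro!: derivative_eq_intros)
    moreover have "((\<lambda>x. 2 * x / (1 - (12/35 * x)\<^sup>2)) has_real_derivative
        2 * (1 + (12/35 * y)\<^sup>2) / A\<^sup>2) (at y)"
      unfolding A_def using s
      by (auto intro!: derivative_eq_intros simp: power2_eq_square)
    ultimately have "(f has_real_derivative (23/35) / (1 + 23/35 * y) - - (23/35) / (1 - 23/35 * y)
       + (12/35) / (1 + 12/35 * y) - - (12/35) / (1 - 12/35 * y) - 2 * (1 + (12/35 * y)\<^sup>2) / A\<^sup>2) (at y)"
      unfolding f_def by (intro DERIV_diff DERIV_add)
    moreover have "(23/35) / (1 + 23/35 * y) - - (23/35) / (1 - 23/35 * y) = (46/35) / B"
      using add_divide_conjugates[of "23/35 * y" "23/35"] s by (simp add: B_def)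
    moreover have "(12/35) / (1 + 12/35 * y) - - (12/35) / (1 - 12/35 * y) = (24/35) / A"
      using add_divide_conjugates[of "12/35 * y" "12/35"] s by (simp add: A_def)
    moreover have "(46/35) / B + (24/35) / A - 2 * (1 + (12/35 * y)\<^sup>2) / A\<^sup>2 = D y"
    proof -
      have "(46/35) / B + (24/35) / A - 2 * (1 + (12/35 * y)\<^sup>2) / A\<^sup>2 =
        ((46/35) * A\<^sup>2 + (24/35) * A * B - 2 * (1 + (12/35 * y)\<^sup>2) * B) / (A\<^sup>2 * B)"
        using AB by (simp add: divide_simps power2_eq_square) (simp add: algebra_simps)
      also have "(46/35) * A\<^sup>2 + (24/35) * A * B - 2 * (1 + (12/35 * y)\<^sup>2) * B =
         2 * y\<^sup>2 * (3312 * y\<^sup>2 - 1225) / 42875"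
        unfolding A_def B_def by (simp add: power2_eq_square field_simps)
      finally show ?thesis unfolding D_def A_def B_def .
    qed
    ultimately show ?thesis
      by (elim DERIV_cong) linarith
  qed
  have D_sign: "D y \<le> 0 \<longleftrightarrow> y\<^sup>2 * (3312 * y\<^sup>2 - 1225) \<le> 0" if "0 \<le> y" "y \<le> 35/47" for y
    using small(5,6)[OF that] by (simp add: D_def divide_le_0_iff mult_le_0_iff)
  show ?thesis
  proof (cases "3312 * x\<^sup>2 \<le> 1225")
    case True
    have "f x \<le> f 0"
    proof (rule DERIV_nonpos_imp_nonincreasing[where f = f])
      fix y assume y: "0 \<le> y" "y \<le> x"
      then have "y\<^sup>2 \<le> x\<^sup>2" by (intro power_mono) auto
      then have "3312 * y\<^sup>2 \<le> 1225" using True by linarith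
      then have "D y \<le> 0" using y assms by (subst D_sign) (auto intro!: mult_nonneg_nonpos)
      then show "\<exists>d. (f has_real_derivative d) (at y) \<and> d \<le> 0" using deriv[of y] y assms by auto
    qed (use assms in auto)
    then show ?thesis by (simp add: f_def)
  next
    case False
    have "f x \<le> f (35/47)"
    proof (rule DERIV_nonneg_imp_nondecreasing[where f = f])
      fix y assume y: "x \<le> y" "y \<le> 35/47"
      then have "x\<^sup>2 \<le> y\<^sup>2" using assms by (intro power_mono) auto
      then have "0 \<le> 3312 * y\<^sup>2 - 1225" using False by linarith
      then have "0 \<le> D y"
        unfolding D_def using y assms(1) small[of y] by (intro divide_nonneg_pos mult_nonneg_nonneg mult_pos_pos) auto
      then show "\<exists>d. (f has_real_derivative d) (at y) \<and> 0 \<le> d" using deriv[of y] y assms by auto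
    qed (use assms in auto)
    also have "f (35/47) = ln (59/12) - 658/413"
    proof -
      have "ln (70/47) + ln (59/47) = ln (59/12 * (24/47) * (35/47) :: real)"
        by (simp flip: ln_mult_pos)
      also have "\<dots> = ln (59/12 * (24/47)) + ln (35/47)" by (rule ln_mult_pos) auto
      also have "ln (59/12 * (24/47)) = ln (59/12) + ln (24/47 :: real)" by (rule ln_mult_pos) auto
      finally show ?thesis by (simp add: f_def power2_eq_square)
    qed
    finally show ?thesis using ln_59_12_le by simp
  qed
qed

text \<open>By monotonicity only the boundary value \<open>q\<close> matters. There
  \<open>q\<close>, \<open>1 - q\<close>, \<open>q + e\<close> and \<open>1 - q - e\<close> are
  halves of \<open>1 \<plusminus> 12/35 * x\<close> and \<open>1 \<plusminus> 23/35 * x\<close> with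
  \<open>x = 2 * e\<close>, which leads to the one-variable inequality.\<close>

lemma deviation_slope_nonpos:
  assumes "0 < e" "e < 35 / 94" "0 < p" "p < 1 / 2 - 12 / 35 * e"
  shows "deviation_slope e p \<le> 0"
proof -
  define q where "q = 1 / 2 - 12 / 35 * e"
  have q: "0 < q" "0 < 1 - q" "0 < 1 - q - e" "0 < q + e" using assms by (auto simp: q_def)
  have "deviation_slope e p \<le> deviation_slope e q"
    using assms by (intro deviation_slope_mono) (auto simp: q_def)
  also have "deviation_slope e q = ln (q + e) - ln q - ln (1 - q - e) + ln (1 - q) - (e / q + e / (1 - q))"
  proof -
    have "1 + e / q = (q + e) / q" "1 - e / (1 - q) = (1 - q - e) / (1 - q)"
      using q by (simp_all add: field_simps)
    then show ?thesis unfolding deviation_slope_def using q by (simp add: ln_div)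
  qed
  also have "e / q + e / (1 - q) = 2 * (2 * e) / (1 - (12/35 * (2 * e))\<^sup>2)"
  proof -
    have "e / q + e / (1 - q) = e / (q * (1 - q))" using q by (simp add: field_simps)
    also have "q * (1 - q) = (1 - (12/35 * (2 * e))\<^sup>2) / 4"
      by (simp add: q_def power2_eq_square algebra_simps)
    finally show ?thesis by simp
  qed
  also have "ln (q + e) - ln q - ln (1 - q - e) + ln (1 - q) =
     ln (1 + 23/35 * (2 * e)) - ln (1 - 23/35 * (2 * e)) + ln (1 + 12/35 * (2 * e)) - ln (1 - 12/35 * (2 * e))"
  proof -
    have "q + e = (1 + 23/35 * (2 * e)) / 2" "q = (1 - 12/35 * (2 * e)) / 2"
      "1 - q - e = (1 - 23/35 * (2 * e)) / 2" "1 - q = (1 + 12/35 * (2 * e)) / 2"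
      by (simp_all add: q_def field_simps)
    moreover have "ln (u / 2) = ln u - ln 2" if "0 < u / 2" for u :: real
      using that by (simp add: ln_div)
    ultimately have "ln (q + e) = ln (1 + 23/35 * (2 * e)) - ln 2" "ln q = ln (1 - 12/35 * (2 * e)) - ln 2"
      "ln (1 - q - e) = ln (1 - 23/35 * (2 * e)) - ln 2" "ln (1 - q) = ln (1 + 12/35 * (2 * e)) - ln 2"
      using q by metis+
    then show ?thesis by linarith
  qed
  also have "\<dots> - 2 * (2 * e) / (1 - (12/35 * (2 * e))\<^sup>2) \<le> 0"
    using assms by (intro critical_slope_nonpos) auto
  finally show ?thesis .
qed

section \<open>Chernoff bounds for \<open>S_B\<close>, and the entropy behind
  \<open>nu\<close>\<close>

text \<open>For \<open>m\<close> outside the open unit interval \<open>S_B\<close> is 0 by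
  convention, so the exponent has to be bounded only inside it.\<close>

lemma S_B_upper_chernoff:
  assumes "0 < r'" "r' \<le> r" "k \<le> n"
    and "0 < m \<Longrightarrow> m < 1 \<Longrightarrow> g \<le> chernoff_exponent r r' (real k / real n) m"
  shows "S_B k n n m \<le> exp (- real n * g)"
proof (cases "0 < m \<and> m < 1")
  case True
  then have "S_B k n n m \<le> exp (- real n * chernoff_exponent r r' (real k / real n) m)"
    using assms upper_tail_chernoff by (simp add: S_B_eq_sum_binom_weight)
  also have "\<dots> \<le> exp (- real n * g)"
    using True assms by (simp add: mult_left_mono)
  finally show ?thesis .
qed (auto simp: S_B_def)

lemma S_B_lower_chernoff:
  assumes "0 < r" "r \<le> r'" "k \<le> n"
    and "0 < m \<Longrightarrow> m < 1 \<Longrightarrow> g \<le> chernoff_exponent r r' (real k / real n) m"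
  shows "S_B 0 k n m \<le> exp (- real n * g)"
proof (cases "0 < m \<and> m < 1")
  case True
  then have "S_B 0 k n m \<le> exp (- real n * chernoff_exponent r r' (real k / real n) m)"
    using assms lower_tail_chernoff by (simp add: S_B_eq_sum_binom_weight)
  also have "\<dots> \<le> exp (- real n * g)"
    using True assms by (simp add: mult_left_mono)
  finally show ?thesis .
qed (auto simp: S_B_def)

text \<open>The logarithm in \<open>nu\<close> splits because
  \<open>1 + t\<^sup>2 / D = (1 + t) * ((t - e) / D)\<close>, and \<open>D / (t - e)\<close> is the
  argument of the second logarithm of the entropy.\<close>

lemma one_plus_nu_mult_ln:
  assumes "0 < e" "0 < t" "e < t - t * e"
  shows "(1 + nu e t) * ln (1 + t) =
    (e / t + e) * ln (1 + t) + (1 - e / t - e) * ln (1 - e / (1 - e / t))"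
proof -
  define D where "D = t - e - t * e"
  have D: "0 < D" "0 < t - e" using assms mult_pos_pos[OF assms(2,1)] unfolding D_def by linarith+
  have "1 + t\<^sup>2 / D = (1 + t) * ((t - e) / D)"
    using D by (simp add: field_simps power2_eq_square) (simp add: D_def algebra_simps)
  then have "ln (1 + t\<^sup>2 / D) = ln (1 + t) - ln (D / (t - e))"
    using assms D by (simp only:) (subst ln_mult_pos, auto simp: ln_div)
  moreover have "D / (t - e) = 1 - e / (1 - e / t)"
    using assms D by (simp add: field_simps) (simp add: D_def algebra_simps)
  moreover have "1 - e / t - e = D / t"
    using assms by (simp add: D_def field_simps)
  moreover have "nu e t * ln (1 + t) = - (D / t) * ln (1 + t\<^sup>2 / D)"
    using assms by (simp add: nu_def D_def field_simps)
  ultimately have "(1 + nu e t) * ln (1 + t) =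
      ln (1 + t) - (1 - e / t - e) * (ln (1 + t) - ln (1 - e / (1 - e / t)))"
    by (simp only: distrib_right)
  then show ?thesis by (simp add: algebra_simps)
qed

section \<open>The stopping rule\<close>

locale tolerances =
  fixes e t :: real
  assumes e: "0 < e" "e < 35 / 94" and t: "70 * e / (35 - 24 * e) < t" "t < 1"
begin

definition p0 :: real where "p0 = e / t"

lemma t_pos: "0 < t"
proof -
  have "0 < 70 * e / (35 - 24 * e)" using e by simp
  then show ?thesis using t by linarith
qed

text \<open>The lower bound on \<open>t\<close> is the upper bound on \<open>p0\<close> in another
  form: divide \<open>70 * e < t * (35 - 24 * e)\<close> by \<open>70 * t\<close>.\<close>

lemma p0: "e < p0" "p0 < 1 / 2 - 12 / 35 * e" "e / p0 = t"
proof -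
  show "e < p0" "e / p0 = t" using e t t_pos by (auto simp: p0_def field_simps)
  have "70 * e < t * (35 - 24 * e)" using t e by (simp add: divide_less_eq)
  then show "p0 < 1 / 2 - 12 / 35 * e" using t_pos by (simp add: p0_def field_simps)
qed

lemma p0_scaled: "t * p0 = e" "p0 + e = p0 * (1 + t)" "p0 - e = p0 * (1 - t)"
  using t_pos by (auto simp: p0_def field_simps)

text \<open>\<open>rate_eq\<close> identifies this as the relative entropy of \<open>p0 + e\<close> with respect to \<open>p0\<close>.\<close>

definition rate :: real where "rate = (1 + nu e t) * ln (1 + t)"

lemma rate_eq: "rate = (p0 + e) * ln (1 + t) + (1 - p0 - e) * ln (1 - e / (1 - p0))"
proof -
  have "p0 + e < 1" using p0 e by simp
  then have "e < t - t * e" using t_pos by (simp add: p0_def field_simps)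
  then show ?thesis unfolding rate_def p0_def by (intro one_plus_nu_mult_ln e t_pos)
qed

text \<open>Gibbs' inequality: \<open>ln y \<le> y - 1\<close> bounds the two terms below by
  \<open>e\<close> and \<open>- e\<close>, the first strictly since \<open>t > 0\<close>. This is
  what yields \<open>0 < 1 + nu e t\<close>.\<close>

lemma rate_pos: "0 < rate"
proof -
  define r' where "r' = 1 - e / (1 - p0)"
  have q: "0 < p0" "0 < 1 - p0" "0 < 1 - p0 - e" using p0 e by auto
  have r': "0 < r'" "1 - p0 - e = r' * (1 - p0)" using q by (auto simp: r'_def field_simps)
  have "ln (1 / (1 + t)) < 1 / (1 + t) - 1"
    using t_pos ln_le_minus_one[of "1 / (1 + t)"] ln_eq_minus_one[of "1 / (1 + t)"]
    by fastforce
  then have "(p0 + e) * ln (1 + t) > (p0 + e) * (1 - 1 / (1 + t))"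
    using t_pos q e by (intro mult_strict_left_mono) (auto simp: ln_div)
  moreover have "(p0 + e) * (1 - 1 / (1 + t)) = e"
  proof -
    have "(p0 + e) / (1 + t) = p0" using t_pos by (simp add: p0_scaled(2))
    then show ?thesis by (simp add: right_diff_distrib)
  qed
  moreover have "ln (1 / r') \<le> 1 / r' - 1"
    using r' by (intro ln_le_minus_one) simp
  then have "(1 - p0 - e) * ln r' \<ge> (1 - p0 - e) * (1 - 1 / r')"
    using r' q by (intro mult_left_mono) (auto simp: ln_div)
  moreover have "(1 - p0 - e) * (1 - 1 / r') = - e"
  proof -
    have "(1 - p0 - e) / r' = 1 - p0" using r' by simp
    then show ?thesis by (simp add: right_diff_distrib)
  qed
  ultimately show ?thesis unfolding rate_eq r'_def[symmetric] by linarith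
qed

lemma nu_neg: "nu e t < 0"
proof -
  have "p0 + e < 1" using p0 e by simp
  then have D: "0 < t - e - t * e" using t_pos by (simp add: p0_def field_simps)
  have "0 < t\<^sup>2 / (t - e - t * e)" using D t_pos by (intro divide_pos_pos) auto
  then have "0 < ln (1 + t\<^sup>2 / (t - e - t * e))" by (intro ln_gt_zero) simp
  moreover have "(e + t * e - t) / (t * ln (1 + t)) < 0"
    using D t_pos by (intro divide_neg_pos) auto
  ultimately show ?thesis unfolding nu_def by (intro mult_neg_pos)
qed

lemma one_plus_nu_pos: "0 < 1 + nu e t"
  using rate_pos t_pos by (simp add: rate_def zero_less_mult_iff)

lemma tau_neg: "0 < \<rho> \<Longrightarrow> tau e t \<rho> < 0"
  using nu_neg one_plus_nu_pos by (simp add: tau_def divide_less_0_iff)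

text \<open>At the corner \<open>(p0 + e, p0)\<close>, where both terms of the minimum agree, the
  exponent equals \<open>rate\<close>. The slope is nonnegative on the ray to the right and
  nonpositive on the absolute segment to the left.\<close>

lemma rate_le_lower:
  "rate \<le> chernoff_exponent (1 + t) (1 - e / (1 - p0)) z (p_lower e t z)"
proof -
  let ?L = "chernoff_exponent (1 + t) (1 - e / (1 - p0))"
  have q: "0 < p0" "0 < 1 - p0" "0 < 1 - p0 - e" using p0 e by auto
  have ray: "(p0 + e) / (1 + t) = p0" using t_pos by (simp add: p0_scaled(2))
  have "(1 - p0) * (1 - e / (1 - p0)) = 1 - p0 - e" using q by (simp add: field_simps)
  then have ref: "?L (p0 + e) p0 = rate"
    using p0_scaled(2) by (simp add: chernoff_exponent_def rate_eq)
  show ?thesis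
  proof (cases "p0 + e \<le> z")
    case True
    then have "t * (p0 + e) \<le> t * z" using t_pos by simp
    then have "e + t * e \<le> t * z" using p0_scaled(1) by (simp add: algebra_simps)
    then have "z \<le> (z - e) * (1 + t)" by (simp add: algebra_simps)
    then have "z / (1 + t) \<le> z - e" using t_pos by (subst pos_divide_le_eq) auto
    then have "p_lower e t z = z / (1 + t)" by (simp add: p_lower_def)
    then show ?thesis
      using chernoff_exponent_ray_mono[of "1 + t" "1 - e / (1 - p0)" "p0 + e" z] True q t_pos
      by (simp add: ref ray)
  next
    case False
    then have "t * z \<le> t * (p0 + e)" using t_pos by simp
    then have "t * z \<le> e + t * e" using p0_scaled(1) by (simp add: algebra_simps)
    then have "p_lower e t z = z - e"
      using t_pos by (simp add: p_lower_def min_def field_simps)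
    moreover have "deviation_slope e p0 \<le> 0"
      using p0 e by (intro deviation_slope_nonpos) auto
    then have "0 \<le> (z - (p0 + e)) * (ln (1 + t) - ln (1 - e / (1 - p0)) - (1 + t) + (1 - e / (1 - p0)))"
      using False by (intro mult_nonpos_nonpos) (simp_all add: deviation_slope_def p0)
    ultimately show ?thesis
      using chernoff_exponent_shift[of "1 + t" "1 - e / (1 - p0)" "p0 + e" "z - (p0 + e)" p0]
      by (simp add: ref)
  qed
qed

text \<open>Same argument at the corner \<open>(p0 - e, p0)\<close>, where the exponent is the
  relative entropy of \<open>p0 - e\<close> and hence at least \<open>rate\<close>.\<close>

lemma rate_le_upper:
  "rate \<le> chernoff_exponent (1 - t) (1 + e / (1 - p0)) z (p_upper e t z)"
proof -
  let ?L = "chernoff_exponent (1 - t) (1 + e / (1 - p0))"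
  have q: "0 < p0" "0 < 1 - p0" using p0 e by auto
  have ray: "(p0 - e) / (1 - t) = p0" using t by (simp add: p0_scaled(3))
  have "(1 - p0) * (1 + e / (1 - p0)) = 1 - p0 + e" using q by (simp add: field_simps)
  then have "?L (p0 - e) p0 = (p0 - e) * ln (1 - e / p0) + (1 - p0 + e) * ln (1 + e / (1 - p0))"
    using p0_scaled(3) by (simp add: chernoff_exponent_def p0(3))
  moreover have "rate \<le> \<dots>"
    unfolding rate_eq using relative_entropy_deviation_le[of e p0] p0 e by simp
  ultimately have ref: "rate \<le> ?L (p0 - e) p0" by simp
  show ?thesis
  proof (cases "p0 - e \<le> z")
    case True
    then have "t * (p0 - e) \<le> t * z" using t_pos by simp
    then have "e - t * e \<le> t * z" using p0_scaled(1) by (simp add: algebra_simps)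
    then have "p_upper e t z = z / (1 - t)"
      using t_pos t by (simp add: p_upper_def max_def field_simps)
    moreover have "0 < 1 + e / (1 - p0)" using q e by (intro add_pos_pos) auto
    ultimately show ?thesis
      using chernoff_exponent_ray_mono[of "1 - t" "1 + e / (1 - p0)" "p0 - e" z] True t ref
      by (simp add: ray)
  next
    case False
    then have "t * z \<le> t * (p0 - e)" using t_pos by simp
    then have "t * z \<le> e - t * e" using p0_scaled(1) by (simp add: algebra_simps)
    then have "p_upper e t z = z + e"
      using t_pos t by (simp add: p_upper_def max_def field_simps)
    moreover have "e / (1 - p0) \<le> e / p0"
      using p0(1,2) e by (intro divide_left_mono) auto
    then have "e / (1 - p0) \<le> t" by (simp only: p0(3))
    then have "ln (1 - t) - ln (1 + e / (1 - p0)) + t + e / (1 - p0) \<le> 0"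
      using t q e by (intro ln_quotient_upper_slope_nonpos) auto
    then have "0 \<le> (z - (p0 - e)) * (ln (1 - t) - ln (1 + e / (1 - p0)) - (1 - t) + (1 + e / (1 - p0)))"
      using False by (intro mult_nonpos_nonpos) simp_all
    ultimately show ?thesis
      using chernoff_exponent_shift[of "1 - t" "1 + e / (1 - p0)" "p0 - e" "z - (p0 - e)" p0] ref
      by (simp add: algebra_simps)
  qed
qed

lemma stop_cond_of_large_sample:
  assumes "k \<le> n" "exp (- real n * rate) \<le> c"
  shows "stop_cond e t c n k"
proof -
  have q: "0 < p0" "0 < 1 - p0" "0 < 1 - p0 - e" using p0 e by auto
  then have s: "0 < e / (1 - p0)" "e / (1 - p0) < 1" using e by (auto simp: field_simps)
  have "S_B k n n (p_lower e t (p_hat n k)) \<le> exp (- real n * rate)"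
    using s t_pos assms(1) rate_le_lower
    by (intro S_B_upper_chernoff[of "1 - e / (1 - p0)" "1 + t"]) (auto simp: p_hat_def)
  moreover have "S_B 0 k n (p_upper e t (p_hat n k)) \<le> exp (- real n * rate)"
    using s t t_pos assms(1) rate_le_upper
    by (intro S_B_lower_chernoff[of "1 - t" "1 + e / (1 - p0)"]) (auto simp: p_hat_def)
  ultimately show ?thesis using assms(2) by (simp add: stop_cond_def)
qed

text \<open>Missing both margins on one side puts \<open>p\<close> beyond both terms of the minimum
  or maximum, hence beyond the limit itself.\<close>

lemma tail_small_of_wrong_stop:
  assumes stop: "stop_cond e t c n k" and k: "k \<le> n" and p: "0 < p" "p < 1"
    and wrong: "\<not> \<bar>p_hat n k - p\<bar> < e" "\<not> \<bar>(p_hat n k - p) / p\<bar> < t"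
  shows "(\<Sum>i=k..n. binom_weight n p i) \<le> c \<or> (\<Sum>i=0..k. binom_weight n p i) \<le> c"
proof -
  define z where "z = p_hat n k"
  have z: "0 \<le> z" "z \<le> 1" using k by (auto simp: z_def p_hat_def divide_le_eq)
  have dev: "e \<le> \<bar>z - p\<bar>" "t * p \<le> \<bar>z - p\<bar>"
    using wrong p by (auto simp: z_def[symmetric] not_less pos_le_divide_eq)
  show ?thesis
  proof (cases "p \<le> z")
    case True
    then have "p \<le> z - e" "p * (1 + t) \<le> z"
      using dev by (simp_all add: distrib_left mult.commute)
    then have "p \<le> p_lower e t z"
      using t_pos by (simp add: p_lower_def pos_le_divide_eq)
    \<comment> \<open>Together with \<open>0 < p\<close> this places the limit inside the unit
      interval, so that the small \<open>S_B\<close> is a true tail and not the default 0.\<close>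
    moreover have "p_lower e t z < 1" using z e by (auto simp: p_lower_def)
    moreover have "S_B k n n (p_lower e t z) \<le> c"
      using stop by (simp add: stop_cond_def z_def)
    ultimately have "(\<Sum>i=k..n. binom_weight n p i) \<le> c"
      using upper_tail_mono[of p "p_lower e t z" n k] p S_B_eq_sum_binom_weight[of "p_lower e t z" k n n]
      by linarith
    then show ?thesis ..
  next
    case False
    then have "z + e \<le> p" "z \<le> p * (1 - t)"
      using dev by (simp_all add: right_diff_distrib mult.commute)
    then have "p_upper e t z \<le> p"
      using t by (simp add: p_upper_def pos_divide_le_eq)
    moreover have "0 < p_upper e t z" using z e by (auto simp: p_upper_def)
    moreover have "S_B 0 k n (p_upper e t z) \<le> c"
      using stop by (simp add: stop_cond_def z_def)
    ultimately have "(\<Sum>i=0..k. binom_weight n p i) \<le> c"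
      using lower_tail_antimono_prob[of "p_upper e t z" p k n] p k
        S_B_eq_sum_binom_weight[of "p_upper e t z" 0 k n]
      by linarith
    then show ?thesis ..
  qed
qed

section \<open>Size and number of the stages\<close>

lemma exists_large_sample_size:
  assumes "0 < \<rho>" "0 < \<zeta> * \<delta>"
  shows "\<exists>m. m \<in> sample_sizes e t \<rho> \<zeta> \<delta> \<and> exp (- real_of_int m * rate) \<le> \<zeta> * \<delta>"
proof -
  define c where "c = \<zeta> * \<delta>"
  have c: "0 < c" using assms by (simp add: c_def)
  have tau: "tau e t \<rho> < 0" using assms by (intro tau_neg)
  \<comment> \<open>The index \<open>i = tau e t \<rho>\<close> gives the exponent -1, and the
    number under the ceiling becomes \<open>ln (1 / c) / rate\<close>.\<close>
  define m where "m = \<lceil>(1 + nu e t) powr (- (real_of_int (tau e t \<rho>) / real_of_int (tau e t \<rho>)))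
        * (ln (1 / (\<zeta> * \<delta>)) / ln (1 + t))\<rceil>"
  have "m \<in> sample_sizes e t \<rho> \<zeta> \<delta>"
    unfolding sample_sizes_def m_def using tau by (intro CollectI exI[of _ "tau e t \<rho>"]) auto
  moreover have "exp (- real_of_int m * rate) \<le> \<zeta> * \<delta>"
  proof -
    have "ln (1 / c) / rate = (1 + nu e t) powr (- (real_of_int (tau e t \<rho>) / real_of_int (tau e t \<rho>)))
        * (ln (1 / (\<zeta> * \<delta>)) / ln (1 + t))"
      using tau one_plus_nu_pos by (simp add: rate_def c_def powr_minus_divide)
    also have "\<dots> \<le> m" unfolding m_def by (rule le_of_int_ceiling)
    finally have "ln (1 / c) \<le> m * rate" using rate_pos by (simp add: pos_divide_le_eq)
    moreover have "ln (1 / c) = - ln c" using c by (simp only: ln_div) simp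
    ultimately have "- real_of_int m * rate \<le> ln c" by linarith
    then have "exp (- real_of_int m * rate) \<le> exp (ln c)" by (simp only: exp_le_cancel_iff)
    also have "\<dots> = \<zeta> * \<delta>" using c by (simp only: exp_ln c_def)
    finally show ?thesis .
  qed
  ultimately show ?thesis by blast
qed

text \<open>One size for each index from \<open>tau e t \<rho>\<close> to 0; ceilings may coincide,
  hence only an inequality.\<close>

lemma card_sample_sizes_le:
  assumes "0 < \<rho>"
  shows "real (card (sample_sizes e t \<rho> \<zeta> \<delta>)) \<le> 1 - real_of_int (tau e t \<rho>)"
proof -
  let ?f = "\<lambda>i. \<lceil>(1 + nu e t) powr (- (real_of_int i / real_of_int (tau e t \<rho>)))
        * (ln (1 / (\<zeta> * \<delta>)) / ln (1 + t))\<rceil>"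
  have "sample_sizes e t \<rho> \<zeta> \<delta> = ?f ` {tau e t \<rho>..0}"
    by (auto simp: sample_sizes_def)
  then have "card (sample_sizes e t \<rho> \<zeta> \<delta>) \<le> card {tau e t \<rho>..0}"
    by (simp only: card_image_le finite_atLeastAtMost_int)
  then show ?thesis using tau_neg[OF assms] by simp
qed

end

section \<open>Termination and coverage probability\<close>

lemma terminates_at_exists:
  assumes "l \<in> {1..s}" "P l"
  shows "\<exists>j. terminates_at s P j"
proof -
  have "\<exists>j. j \<in> {1..s} \<and> P j" using assms by blast
  then obtain j where "j \<in> {1..s} \<and> P j" "\<And>i. i < j \<Longrightarrow> \<not> (i \<in> {1..s} \<and> P i)"
    unfolding exists_least_iff[of "\<lambda>j. j \<in> {1..s} \<and> P j"] by blast
  then have "terminates_at s P j"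
    unfolding terminates_at_def by (metis atLeastAtMost_iff atLeastLessThan_iff less_imp_le order_trans)
  then show ?thesis ..
qed

theorem theorem4:
  fixes \<delta> \<zeta> \<rho> \<epsilon>\<^sub>a \<epsilon>\<^sub>r p :: real
    and s :: nat and n :: "nat \<Rightarrow> nat"
    and M :: "'a measure" and X :: "nat \<Rightarrow> 'a \<Rightarrow> nat"
    and K :: "nat \<Rightarrow> 'a \<Rightarrow> nat"
  assumes "0 < \<delta>" "\<delta> < 1" "\<zeta> > 0" "\<rho> > 0"
    and "0 < \<epsilon>\<^sub>a" "\<epsilon>\<^sub>a < 35 / 94"
    and "70 * \<epsilon>\<^sub>a / (35 - 24 * \<epsilon>\<^sub>a) < \<epsilon>\<^sub>r" "\<epsilon>\<^sub>r < 1"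
    and "strict_mono_on {1..s} n"
    and "(\<lambda>l. int (n l)) ` {1..s} = sample_sizes \<epsilon>\<^sub>a \<epsilon>\<^sub>r \<rho> \<zeta> \<delta>"
    and "0 < p" "p < 1"
    and "prob_space M"
    and "prob_space.indep_vars M (\<lambda>_. count_space UNIV) X {1..}"
    and "\<And>i. i \<ge> 1 \<Longrightarrow> measure M {\<omega> \<in> space M. X i \<omega> = 1} = p"
    and "\<And>i. i \<ge> 1 \<Longrightarrow> measure M {\<omega> \<in> space M. X i \<omega> = 0} = 1 - p"
    and "\<And>l \<omega>. K l \<omega> = (\<Sum>i=1..n l. X i \<omega>)"
    and "\<zeta> \<le> 1 / (2 * (1 - real_of_int (tau \<epsilon>\<^sub>a \<epsilon>\<^sub>r \<rho>)))"
  shows "measure M {\<omega> \<in> space M. \<exists>l.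
      terminates_at s (\<lambda>j. stop_cond \<epsilon>\<^sub>a \<epsilon>\<^sub>r (\<zeta> * \<delta>) (n j) (K j \<omega>)) l \<and>
      (\<bar>p_hat (n l) (K l \<omega>) - p\<bar> < \<epsilon>\<^sub>a \<or>
       \<bar>(p_hat (n l) (K l \<omega>) - p) / p\<bar> < \<epsilon>\<^sub>r)} \<ge> 1 - \<delta>"
proof -
  interpret prob_space M by fact
  interpret tolerances \<epsilon>\<^sub>a \<epsilon>\<^sub>r using assms by unfold_locales
  note p = \<open>0 < p\<close> \<open>p < 1\<close>
  define c where "c = \<zeta> * \<delta>"
  have c: "0 < c" using assms by (simp add: c_def)
  have "X i \<in> measurable M (count_space UNIV)" if "i \<ge> 1" for i
    using assms(14) that by (auto simp: indep_vars_def)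
  then have K[measurable]: "K l \<in> measurable M (count_space UNIV)" for l
    unfolding assms(17)[abs_def] by (intro measurable_sum_nat) auto
  have dist: "prob {\<omega> \<in> space M. K l \<omega> = k} = binom_weight (n l) p k" for l k
    unfolding assms(17) by (intro sum_bernoulli_binomial assms)
  \<comment> \<open>The weights up to \<open>n l\<close> already sum to 1; larger counts form a null
    set.\<close>
  have le: "AE \<omega> in M. K l \<omega> \<le> n l" for l
  proof -
    have "prob (\<Union>k\<in>{..n l}. {\<omega> \<in> space M. K l \<omega> = k}) = (\<Sum>k\<le>n l. prob {\<omega> \<in> space M. K l \<omega> = k})"
      by (intro finite_measure_finite_Union) (auto simp: disjoint_family_on_def)
    then have "prob (\<Union>k\<in>{..n l}. {\<omega> \<in> space M. K l \<omega> = k}) = 1"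
      by (simp add: dist sum_binom_weight)
    from AE_prob_1[OF this] show ?thesis by eventually_elim auto
  qed
  define U where "U l = {\<omega> \<in> space M. K l \<omega> \<le> n l \<and> (\<Sum>i=K l \<omega>..n l. binom_weight (n l) p i) \<le> c}" for l
  define L where "L l = {\<omega> \<in> space M. K l \<omega> \<le> n l \<and> (\<Sum>i=0..K l \<omega>. binom_weight (n l) p i) \<le> c}" for l
  have U[measurable]: "U l \<in> events" and L[measurable]: "L l \<in> events" for l
    unfolding U_def L_def by measurable
  \<comment> \<open>These events refer to fixed stages, not to the random stopping stage, so a union
    bound over the stages applies.\<close>
  define Bad where "Bad = (\<Union>l\<in>{1..s}. U l \<union> L l)"
  have Bad[measurable]: "Bad \<in> events" unfolding Bad_def by measurable
  define stop where "stop l \<omega> \<longleftrightarrow> stop_cond \<epsilon>\<^sub>a \<epsilon>\<^sub>r c (n l) (K l \<omega>)" for l \<omega>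
  define acc where "acc l \<omega> \<longleftrightarrow> \<bar>p_hat (n l) (K l \<omega>) - p\<bar> < \<epsilon>\<^sub>a \<or>
       \<bar>(p_hat (n l) (K l \<omega>) - p) / p\<bar> < \<epsilon>\<^sub>r" for l \<omega>
  define Good where "Good = {\<omega> \<in> space M. \<exists>l. terminates_at s (\<lambda>j. stop j \<omega>) l \<and> acc l \<omega>}"
  have [measurable]: "Measurable.pred M (stop l)" "Measurable.pred M (acc l)" for l
    unfolding stop_def acc_def by measurable
  \<comment> \<open>A bounded range for \<open>l\<close> exhibits the event as a finite combination
    of measurable ones.\<close>
  have "Good = {\<omega> \<in> space M. \<exists>l\<in>{1..s}. (stop l \<omega> \<and> (\<forall>j\<in>{1..<l}. \<not> stop j \<omega>)) \<and> acc l \<omega>}"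
    by (auto simp: Good_def terminates_at_def)
  also have "\<dots> \<in> events" by measurable
  finally have Good: "Good \<in> events" .

  obtain m where "m \<in> sample_sizes \<epsilon>\<^sub>a \<epsilon>\<^sub>r \<rho> \<zeta> \<delta>" "exp (- real_of_int m * rate) \<le> c"
    using exists_large_sample_size[OF assms(4), of \<zeta> \<delta>] c unfolding c_def by blast
  then obtain l\<^sub>0 where l\<^sub>0: "l\<^sub>0 \<in> {1..s}" "exp (- real (n l\<^sub>0) * rate) \<le> c"
    unfolding assms(10)[symmetric] by auto
  have "AE \<omega> in M. \<forall>l\<in>{1..s}. K l \<omega> \<le> n l"
    using le by (intro AE_finite_allI) auto
  then have "AE \<omega> in M. \<omega> \<in> space M - Bad \<longrightarrow> \<omega> \<in> Good"
  proof eventually_elim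
    case (elim \<omega>)
    show ?case
    proof
      assume \<omega>: "\<omega> \<in> space M - Bad"
      have "stop l\<^sub>0 \<omega>"
        unfolding stop_def using elim l\<^sub>0 by (intro stop_cond_of_large_sample) auto
      then obtain l where l: "terminates_at s (\<lambda>j. stop j \<omega>) l"
        using terminates_at_exists[of l\<^sub>0 s "\<lambda>j. stop j \<omega>"] l\<^sub>0 by blast
      then have ls: "l \<in> {1..s}" "stop l \<omega>" by (auto simp: terminates_at_def)
      have "acc l \<omega>"
      proof (rule ccontr)
        assume "\<not> acc l \<omega>"
        then have "(\<Sum>i=K l \<omega>..n l. binom_weight (n l) p i) \<le> c \<or>
            (\<Sum>i=0..K l \<omega>. binom_weight (n l) p i) \<le> c"
          using ls elim p unfolding stop_def acc_def
          by (intro tail_small_of_wrong_stop) blast+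
        then have "\<omega> \<in> U l \<union> L l"
          using ls elim \<omega> unfolding U_def L_def by blast
        then show False using ls \<omega> unfolding Bad_def by blast
      qed
      then show "\<omega> \<in> Good" using l \<omega> by (auto simp: Good_def)
    qed
  qed
  then have "prob (space M - Bad) \<le> prob Good"
    using Good by (intro finite_measure_mono_AE) auto
  moreover have "prob Bad \<le> \<delta>"
  proof -
    have "prob Bad \<le> (\<Sum>l=1..s. prob (U l \<union> L l))"
      unfolding Bad_def by (intro finite_measure_subadditive_finite) auto
    also have "\<dots> \<le> (\<Sum>l=1..s. 2 * c)"
    proof (rule sum_mono)
      fix l
      have "prob (U l \<union> L l) \<le> prob (U l) + prob (L l)"
        by (intro measure_Un_le) auto
      also have "\<dots> \<le> c + c"
        unfolding U_def L_def using p c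
        by (intro add_mono binomial_tail_p_value_upper binomial_tail_p_value_lower dist K) auto
      finally show "prob (U l \<union> L l) \<le> 2 * c" by simp
    qed
    also have "\<dots> = 2 * real s * c" by simp
    \<comment> \<open>Strict monotonicity of \<open>n\<close> makes \<open>s\<close> the number of
      distinct sample sizes.\<close>
    also have "\<dots> \<le> 2 * (1 - real_of_int (tau \<epsilon>\<^sub>a \<epsilon>\<^sub>r \<rho>)) * c"
    proof -
      have "inj_on n {1..s}"
        using assms(9) by (rule strict_mono_on_imp_inj_on)
      from comp_inj_on[OF this inj_on_of_nat] have "inj_on (\<lambda>l. int (n l)) {1..s}"
        unfolding comp_def .
      from card_image[OF this] have "card (sample_sizes \<epsilon>\<^sub>a \<epsilon>\<^sub>r \<rho> \<zeta> \<delta>) = s"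
        unfolding assms(10) by (simp only: card_atLeastAtMost diff_Suc_1)
      with card_sample_sizes_le[OF assms(4), of \<zeta> \<delta>]
      have "real s \<le> 1 - real_of_int (tau \<epsilon>\<^sub>a \<epsilon>\<^sub>r \<rho>)" by (simp only:)
      then show ?thesis
        using c by (intro mult_right_mono) auto
    qed
    also have "\<dots> \<le> \<delta>"
    proof -
      have "0 < 2 * (1 - real_of_int (tau \<epsilon>\<^sub>a \<epsilon>\<^sub>r \<rho>))"
        using tau_neg[OF assms(4)] by simp
      then have "\<zeta> * (2 * (1 - real_of_int (tau \<epsilon>\<^sub>a \<epsilon>\<^sub>r \<rho>))) \<le> 1"
        using assms(18) by (simp only: pos_le_divide_eq)
      from mult_right_mono[OF this, of \<delta>] show ?thesis
        using \<open>0 < \<delta>\<close> by (simp only: c_def mult_ac) simp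
    qed
    finally show ?thesis .
  qed
  ultimately have "1 - \<delta> \<le> prob Good"
    using prob_compl[OF Bad] by linarith
  then show ?thesis
    unfolding Good_def stop_def acc_def c_def .
qed

end
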